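(* Let $X$ be a metric space equipped with a closed partial order $\le$, and let $\mu,\nu\in\mathcal{P}(X)$. Then the following are equivalent: (1) $\nu\le\mu$ in the stochastic order; (2) for every antitone Borel function $f:X\to[0,\infty)$, $\int_X f\,d\mu\le\int_X f\,d\nu$; (2$'$) for every antitone bounded Borel function $f:X\to[0,\infty)$, $\int_X f\,d\mu\le\int_X f\,d\nu$; (3) for every antitone lower semicontinuous function $f:X\to[0,\infty)$, $\int_X f\,d\mu\le\int_X f\,d\nu$; (3$'$) for every antitone bounded lower semicontinuous function $f:X\to[0,\infty)$, $\int_X f\,d\mu\le\int_X f\,d\nu$. (Integrals are allowed to be $+\infty$.)
   Context: A partial order $\le$ on a metric space $X$ is closed if $\{(x,y):x\le y\}$ is closed in $X\times X$. A subset $A\subseteq X$ is an upper set if $x\in A$ and $x\le y$ imply $y\in A$. A real function $f$ on $X$ is antitone if $x\le y$ implies $f(x)\ge f(y)$. $\mathcal{P}(X)$ denotes the set of Borel probability measures $\mu$ on $X$ satisfying all four of the following conditions: the support of $\mu$ has measure $1$; $\mu$ is $\tau$-additive, i.e. $\mu(U)=\sup_\alpha\mu(U_\alpha)$ for every directed union $U=\bigcup_\alpha U_\alpha$ of open sets; $\mu$ is the weak limit of a sequence of finitely supported measures; $\mu$ is inner regular, i.e. for every Borel set $A$ and $\varepsilon>0$ there is a compact $K\subseteq A$ with $\mu(A)-\varepsilon<\mu(K)$. (The first three are always equivalent, and all four are equivalent when $X$ is complete.) The stochastic order on $\mathcal{P}(X)$ is defined by: $\mu\le\nu$ if $\mu(U)\le\nu(U)$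 for each open upper set $U\subseteq X$. *)

theory Defs
  imports "HOL-Probability.Probability"
begin

definition closed_partial_order :: "('a::metric_space \<Rightarrow> 'a \<Rightarrow> bool) \<Rightarrow> bool" where
  "closed_partial_order le \<longleftrightarrow>
     reflp le \<and> antisymp le \<and> transp le \<and> closed {(x, y). le x y}"

definition upper_set :: "('a \<Rightarrow> 'a \<Rightarrow> bool) \<Rightarrow> 'a set \<Rightarrow> bool" where
  "upper_set le A \<longleftrightarrow> (\<forall>x y. x \<in> A \<longrightarrow> le x y \<longrightarrow> y \<in> A)"

abbreviation antitone :: "('a \<Rightarrow> 'a \<Rightarrow> bool) \<Rightarrow> ('a \<Rightarrow> real) \<Rightarrow> bool" where
  "antitone le f \<equiv> monotone le (\<ge>) f"

definition lower_semicontinuous :: "('a::topological_space \<Rightarrow> real) \<Rightarrow> bool" where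
  "lower_semicontinuous f \<longleftrightarrow> (\<forall>c. open {x. c < f x})"

definition borel_prob :: "'a::topological_space measure \<Rightarrow> bool" where
  "borel_prob M \<longleftrightarrow> sets M = sets borel \<and> prob_space M"

definition msupport :: "'a::topological_space measure \<Rightarrow> 'a set" where
  "msupport M = {x. \<forall>U. open U \<longrightarrow> x \<in> U \<longrightarrow> emeasure M U > 0}"

definition tau_additive :: "'a::topological_space measure \<Rightarrow> bool" where
  "tau_additive M \<longleftrightarrow>
     (\<forall>\<U>. \<U> \<noteq> {} \<longrightarrow> (\<forall>U\<in>\<U>. open U) \<longrightarrow>
          (\<forall>U\<in>\<U>. \<forall>V\<in>\<U>. \<exists>W\<in>\<U>. U \<subseteq> W \<and> V \<subseteq> W) \<longrightarrow>
          emeasure M (\<Union>\<U>) = (SUP U\<in>\<U>. emeasure M U))"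

text \<open>Finitely supported means concentrated on a finite set. Asking only that
  \<^term>\<open>msupport M\<close> be finite would not do: on a nonseparable space it is not automatic that the support
  of a Borel probability measure has full measure.\<close>

definition finitely_supported :: "'a::metric_space measure \<Rightarrow> bool" where
  "finitely_supported M \<longleftrightarrow> (\<exists>F. finite F \<and> emeasure M F = 1)"

definition weak_limit :: "(nat \<Rightarrow> 'a::topological_space measure) \<Rightarrow> 'a measure \<Rightarrow> bool" where
  "weak_limit N M \<longleftrightarrow>
     (\<forall>f :: 'a \<Rightarrow> real. continuous_on UNIV f \<longrightarrow> bounded (range f) \<longrightarrow>
        (\<lambda>n. \<integral>x. f x \<partial>N n) \<longlonglongrightarrow> (\<integral>x. f x \<partial>M))"

definition compact_inner_regular :: "'a::topological_space measure \<Rightarrow> bool" where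
  "compact_inner_regular M \<longleftrightarrow>
     (\<forall>A\<in>sets borel. \<forall>\<epsilon>>0. \<exists>K. compact K \<and> K \<subseteq> A \<and> measure M A - \<epsilon> < measure M K)"

text \<open>The class \<open>\<P>(X)\<close>.\<close>

definition prob_measures :: "'a::metric_space measure set" where
  "prob_measures = {M. borel_prob M
     \<and> emeasure M (msupport M) = 1
     \<and> tau_additive M
     \<and> (\<exists>N. (\<forall>n. borel_prob (N n) \<and> finitely_supported (N n)) \<and> weak_limit N M)
     \<and> compact_inner_regular M}"

definition stochastic_le ::
    "('a::topological_space \<Rightarrow> 'a \<Rightarrow> bool) \<Rightarrow> 'a measure \<Rightarrow> 'a measure \<Rightarrow> bool" where
  "stochastic_le le M N \<longleftrightarrow>
     (\<forall>U. open U \<longrightarrow> upper_set le U \<longrightarrow> emeasure M U \<le> emeasure N U)"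

end

theory Submission
  imports Defs
begin

text \<open>
  Inner regularity lets one pass from an arbitrary Borel lower (or upper) set to a closed one: the
  order being closed, the lower closure of a compact set is closed, and it stays inside any
  lower set that contains the compact set. Hence an inequality between measures of closed lower
  sets extends to all Borel lower sets, and by the layer cake formula to integrals of antitone
  functions. Conversely, the indicator of an open lower set is antitone, bounded and lower semicontinuous,
  and the same closure argument applied to upper sets recovers the stochastic order.
\<close>

text \<open>Compactness makes the witnesses in \<open>K\<close> for a convergent sequence
  subconverge, and the closed relation passes to the limit pair.\<close>

lemma closed_compact_relation_image:
  fixes R :: "'a::metric_space \<Rightarrow> 'b::metric_space \<Rightarrow> bool"
  assumes "compact K" and "closed {(x, y). R x y}"
  shows "closed {y. \<exists>x\<in>K. R x y}"
  unfolding closed_sequential_limits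
proof (intro allI impI, elim conjE)
  fix b l
  assume "\<forall>n. b n \<in> {y. \<exists>x\<in>K. R x y}" and b: "b \<longlonglongrightarrow> l"
  then obtain a where a: "\<And>n. a n \<in> K" "\<And>n. R (a n) (b n)"
    by simp metis
  then obtain k r where k: "k \<in> K" and r: "strict_mono r" and "(a \<circ> r) \<longlonglongrightarrow> k"
    using \<open>compact K\<close> unfolding compact_def by metis
  then have "(\<lambda>n. ((a \<circ> r) n, (b \<circ> r) n)) \<longlonglongrightarrow> (k, l)"
    using LIMSEQ_subseq_LIMSEQ[OF b r] by (intro tendsto_Pair)
  moreover have "((a \<circ> r) n, (b \<circ> r) n) \<in> {(x, y). R x y}" for n
    using a by simp
  ultimately have "(k, l) \<in> {(x, y). R x y}"
    by (rule closed_sequentially[OF assms(2), rotated])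
  then show "l \<in> {y. \<exists>x\<in>K. R x y}"
    using k by auto
qed

lemma closed_upper_closure_compact:
  assumes "closed_partial_order le" and "compact K"
  shows "closed {y. \<exists>x\<in>K. le x y}"
  using assms by (intro closed_compact_relation_image) (auto simp: closed_partial_order_def)

text \<open>The converse graph is the preimage of a closed graph under the continuous coordinate
  swap.\<close>

lemma closed_partial_order_converse:
  assumes "closed_partial_order le"
  shows "closed_partial_order (\<lambda>x y. le y x)"
proof -
  have "closed ((\<lambda>(x, y). (y, x)) -` {(x, y). le x y})"
    using assms continuous_on_swap[of UNIV]
    by (intro continuous_closed_vimage)
      (simp_all add: closed_partial_order_def continuous_on_eq_continuous_at prod.swap_def case_prod_beta')
  moreover have "(\<lambda>(x, y). (y, x)) -` {(x, y). le x y} = {(x, y). le y x}"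
    by auto
  ultimately show ?thesis
    using assms
    by (auto simp: closed_partial_order_def reflp_def antisymp_def intro!: transpI elim: transpE)
qed

lemma upper_set_converse_Compl:
  "upper_set (\<lambda>x y. le y x) (- A) \<longleftrightarrow> upper_set le A"
  by (auto simp: upper_set_def)

text \<open>Turns the epsilon form of inner regularity into a supremum principle: only compact
  subsets need to be estimated.\<close>

lemma compact_inner_regular_le:
  assumes "borel_prob M" and "compact_inner_regular M" and "A \<in> sets borel"
    and "\<And>K. compact K \<Longrightarrow> K \<subseteq> A \<Longrightarrow> emeasure M K \<le> ennreal c" and "0 \<le> c"
  shows "emeasure M A \<le> ennreal c"
proof -
  interpret prob_space M
    using assms(1) by (simp add: borel_prob_def)
  have "measure M A \<le> c"
  proof (rule field_le_epsilon)
    fix e :: real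
    assume "0 < e"
    then obtain K where K: "compact K" "K \<subseteq> A" "measure M A - e < measure M K"
      using assms(2,3) unfolding compact_inner_regular_def by blast
    \<comment> \<open>\<open>ennreal\<close> sends negative reals to 0, so \<open>0 \<le> c\<close>
      lets the bound be read in the reals.\<close>
    have "measure M K \<le> c"
      using assms(4)[OF K(1,2)] \<open>0 \<le> c\<close> by (simp add: emeasure_eq_measure)
    then show "measure M A \<le> c + e"
      using K(3) by linarith
  qed
  then show ?thesis
    by (simp add: emeasure_eq_measure ennreal_leI)
qed

text \<open>Stated for upper sets; lower sets are covered by passing to the converse order.\<close>

lemma emeasure_upper_set_le_if_closed:
  assumes "closed_partial_order le"
    and M: "borel_prob M" "compact_inner_regular M" and N: "borel_prob N"
    and closed_le: "\<And>C. closed C \<Longrightarrow> upper_set le C \<Longrightarrow> emeasure M C \<le> emeasure N C"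
    and A: "A \<in> sets borel" "upper_set le A"
  shows "emeasure M A \<le> emeasure N A"
proof -
  interpret N: prob_space N
    using N by (simp add: borel_prob_def)
  have "emeasure M A \<le> ennreal (measure N A)"
  proof (rule compact_inner_regular_le[OF M A(1)])
    fix K
    assume K: "compact K" "K \<subseteq> A"
    \<comment> \<open>The smallest upper set containing \<open>K\<close>, so
      \<open>K \<subseteq> C \<subseteq> A\<close>; the hypothesis on closed upper sets bridges
      \<open>M\<close> and \<open>N\<close> at \<open>C\<close>.\<close>
    define C where "C = {y. \<exists>x\<in>K. le x y}"
    have C: "closed C"
      unfolding C_def using closed_upper_closure_compact[OF assms(1) K(1)] .
    have "upper_set le C"
      using assms(1) unfolding C_def upper_set_def closed_partial_order_def
      by (blast elim: transpE)
    have "K \<subseteq> C"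
      using assms(1) by (auto simp: C_def closed_partial_order_def reflp_def)
    then have "emeasure M K \<le> emeasure M C"
      using C M(1) by (intro emeasure_mono) (auto simp: borel_prob_def)
    also have "\<dots> \<le> emeasure N C"
      using C \<open>upper_set le C\<close> by (rule closed_le)
    also have "\<dots> \<le> emeasure N A"
      using K(2) A N by (intro emeasure_mono) (auto simp: C_def upper_set_def borel_prob_def)
    finally show "emeasure M K \<le> ennreal (measure N A)"
      by (simp add: N.emeasure_eq_measure)
  qed simp
  then show ?thesis
    by (simp add: N.emeasure_eq_measure)
qed

text \<open>Both total masses are 1, so complementing reverses the comparison. This links open sets,
  on which the stochastic order is defined, with closed ones.\<close>

lemma emeasure_Compl_le_iff:
  assumes "borel_prob M" and "borel_prob N" and "A \<in> sets borel"
  shows "emeasure M (- A) \<le> emeasure N (- A) \<longleftrightarrow> emeasure N A \<le> emeasure M A"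
proof -
  interpret M: prob_space M
    using assms(1) by (simp add: borel_prob_def)
  interpret N: prob_space N
    using assms(2) by (simp add: borel_prob_def)
  have "sets M = sets borel" "sets N = sets borel"
    using assms by (auto simp: borel_prob_def)
  moreover from this have "space M = UNIV" "space N = UNIV"
    by (auto dest: sets_eq_imp_space_eq)
  ultimately show ?thesis
    using assms(3) M.prob_compl[of A] N.prob_compl[of A]
    by (simp add: M.emeasure_eq_measure N.emeasure_eq_measure Compl_eq_Diff_UNIV)
qed

text \<open>Tonelli applied to the region under the graph of \<open>f\<close>: vertical slices have
  length \<open>f x\<close>, horizontal ones are strict superlevel sets.\<close>

lemma nn_integral_layer_cake:
  fixes f :: "'a \<Rightarrow> real"
  assumes "sigma_finite_measure M" and [measurable]: "f \<in> borel_measurable M"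
    and nonneg: "\<And>x. 0 \<le> f x"
  shows "(\<integral>\<^sup>+ x. ennreal (f x) \<partial>M) =
    (\<integral>\<^sup>+ t. indicator {0..} t * emeasure M {x \<in> space M. t < f x} \<partial>lborel)"
proof -
  interpret sigma_finite_measure M by fact
  interpret pair_sigma_finite M lborel
    by unfold_locales
  have "(\<integral>\<^sup>+ x. ennreal (f x) \<partial>M) =
    (\<integral>\<^sup>+ x. (\<integral>\<^sup>+ t. indicator {0..<f x} t \<partial>lborel) \<partial>M)"
    using nonneg by simp
  \<comment> \<open>The integrand is rewritten as the indicator of one set in the product space,
    whose joint measurability is what exchanging the integrals requires.\<close>
  also have "\<dots> = (\<integral>\<^sup>+ x. (\<integral>\<^sup>+ t. indicator {p \<in> space (M \<Otimes>\<^sub>M lborel). 0 \<le> snd p \<and> snd p < f (fst p)} (x, t) \<partial>lborel) \<partial>M)"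
    by (intro nn_integral_cong) (auto simp: indicator_def space_pair_measure)
  also have "\<dots> = (\<integral>\<^sup>+ t. (\<integral>\<^sup>+ x. indicator {p \<in> space (M \<Otimes>\<^sub>M lborel). 0 \<le> snd p \<and> snd p < f (fst p)} (x, t) \<partial>M) \<partial>lborel)"
    by (rule Fubini'[symmetric]) measurable
  also have "\<dots> = (\<integral>\<^sup>+ t. (\<integral>\<^sup>+ x. indicator {0..} t * indicator {x \<in> space M. t < f x} x \<partial>M) \<partial>lborel)"
    by (intro nn_integral_cong) (auto simp: indicator_def space_pair_measure)
  also have "\<dots> = (\<integral>\<^sup>+ t. indicator {0..} t * emeasure M {x \<in> space M. t < f x} \<partial>lborel)"
    by (intro nn_integral_cong) (simp add: nn_integral_cmult)
  finally show ?thesis .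
qed

lemma borel_measurable_lower_semicontinuous:
  assumes "lower_semicontinuous f"
  shows "f \<in> borel_measurable borel"
  using assms by (auto simp: borel_measurable_iff_greater lower_semicontinuous_def)

lemma stochastic_le_imp_nn_integral_le:
  fixes f :: "'a::metric_space \<Rightarrow> real"
  assumes le: "closed_partial_order le" and \<mu>: "\<mu> \<in> prob_measures" and \<nu>: "\<nu> \<in> prob_measures"
    and "stochastic_le le \<nu> \<mu>"
    and f: "f \<in> borel_measurable borel" "antitone le f" "\<And>x. 0 \<le> f x"
  shows "(\<integral>\<^sup>+ x. ennreal (f x) \<partial>\<mu>) \<le> (\<integral>\<^sup>+ x. ennreal (f x) \<partial>\<nu>)"
proof -
  have sets: "sets \<mu> = sets borel" "sets \<nu> = sets borel"
    and bp: "borel_prob \<mu>" "borel_prob \<nu>" and sf: "sigma_finite_measure \<mu>" "sigma_finite_measure \<nu>"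
    using \<mu> \<nu> by (auto simp: prob_measures_def borel_prob_def prob_space_imp_sigma_finite)
  have space: "space \<mu> = UNIV" "space \<nu> = UNIV"
    using sets by (auto dest: sets_eq_imp_space_eq)
  \<comment> \<open>Superlevel sets of an antitone function are lower sets, that is, upper sets for
    the converse order.\<close>
  have level: "emeasure \<mu> {x. t < f x} \<le> emeasure \<nu> {x. t < f x}" for t
  proof (rule emeasure_upper_set_le_if_closed[OF closed_partial_order_converse[OF le] bp(1) _ bp(2)])
    show "compact_inner_regular \<mu>"
      using \<mu> by (simp add: prob_measures_def)
    show "{x. t < f x} \<in> sets borel"
      using f(1) by (simp add: borel_measurable_iff_greater)
    show "upper_set (\<lambda>x y. le y x) {x. t < f x}"
      using f(2) by (force simp: upper_set_def monotone_def)
  next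
    \<comment> \<open>The complement of \<open>C\<close> is an open upper set for \<open>le\<close>,
      where the stochastic order applies directly.\<close>
    fix C
    assume "closed C" and "upper_set (\<lambda>x y. le y x) C"
    then have "emeasure \<nu> (- C) \<le> emeasure \<mu> (- C)"
      using \<open>stochastic_le le \<nu> \<mu>\<close> upper_set_converse_Compl[of "\<lambda>x y. le y x" C]
      by (auto simp: stochastic_le_def)
    then show "emeasure \<mu> C \<le> emeasure \<nu> C"
      using emeasure_Compl_le_iff[OF bp(2,1)] \<open>closed C\<close> by auto
  qed
  have meas: "f \<in> borel_measurable \<mu>" "f \<in> borel_measurable \<nu>"
    using f(1) sets by (simp_all cong: measurable_cong_sets)
  show ?thesis
    unfolding nn_integral_layer_cake[OF sf(1) meas(1) f(3)] nn_integral_layer_cake[OF sf(2) meas(2) f(3)] space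
    using level by (intro nn_integral_mono mult_left_mono) auto
qed

text \<open>The test functions form the smallest of the four classes, so each integral condition
  supplies \<open>int_le\<close>.\<close>

lemma nn_integral_le_imp_stochastic_le:
  fixes le :: "'a::metric_space \<Rightarrow> 'a \<Rightarrow> bool"
  assumes le: "closed_partial_order le" and \<mu>: "\<mu> \<in> prob_measures" and \<nu>: "\<nu> \<in> prob_measures"
    and int_le: "\<And>f :: 'a \<Rightarrow> real. (\<And>x. 0 \<le> f x) \<Longrightarrow> antitone le f \<Longrightarrow> bounded (range f) \<Longrightarrow>
      lower_semicontinuous f \<Longrightarrow> (\<integral>\<^sup>+ x. ennreal (f x) \<partial>\<mu>) \<le> (\<integral>\<^sup>+ x. ennreal (f x) \<partial>\<nu>)"
  shows "stochastic_le le \<nu> \<mu>"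
proof -
  have sets: "sets \<mu> = sets borel" "sets \<nu> = sets borel"
    and bp: "borel_prob \<mu>" "borel_prob \<nu>" and reg: "compact_inner_regular \<nu>"
    using \<mu> \<nu> by (auto simp: prob_measures_def borel_prob_def)
  \<comment> \<open>Closed upper sets come first: their complements are open and have lower
    semicontinuous indicators. For an open upper set the indicator of the complement is in general
    only upper semicontinuous, so inner regularity of \<open>\<nu>\<close> bridges the gap.\<close>
  have closed_le: "emeasure \<nu> C \<le> emeasure \<mu> C" if C: "closed C" "upper_set le C" for C
  proof -
    let ?f = "indicator (- C) :: 'a \<Rightarrow> real"
    have "antitone le ?f"
      using C(2) by (auto simp: monotone_def indicator_def upper_set_def)
    moreover have "bounded (range ?f)"
      by (rule boundedI[where B = 1]) (auto simp: indicator_def)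
    moreover have "lower_semicontinuous ?f"
      unfolding lower_semicontinuous_def
    proof
      fix c :: real
      have "{x. c < ?f x} = (if c < 0 then UNIV else if c < 1 then - C else {})"
        by (auto simp: indicator_def)
      then show "open {x. c < ?f x}"
        using C(1) by (simp add: open_Compl)
    qed
    ultimately have "(\<integral>\<^sup>+ x. ennreal (?f x) \<partial>\<mu>) \<le> (\<integral>\<^sup>+ x. ennreal (?f x) \<partial>\<nu>)"
      by (intro int_le) auto
    then have "emeasure \<mu> (- C) \<le> emeasure \<nu> (- C)"
      using C(1) sets by (simp add: ennreal_indicator)
    then show ?thesis
      using emeasure_Compl_le_iff[OF bp] C(1) by auto
  qed
  show ?thesis
    unfolding stochastic_le_def
    using emeasure_upper_set_le_if_closed[OF le bp(2) reg bp(1) closed_le] by auto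
qed

theorem corollary3p7:
  fixes le :: "'a::metric_space \<Rightarrow> 'a \<Rightarrow> bool"
    and \<mu> \<nu> :: "'a measure"
  assumes "closed_partial_order le"
    and "\<mu> \<in> prob_measures"
    and "\<nu> \<in> prob_measures"
  shows "(stochastic_le le \<nu> \<mu> \<longleftrightarrow>
       (\<forall>f :: 'a \<Rightarrow> real. (\<forall>x. 0 \<le> f x) \<longrightarrow> antitone le f \<longrightarrow> f \<in> borel_measurable borel \<longrightarrow>
          (\<integral>\<^sup>+ x. ennreal (f x) \<partial>\<mu>) \<le> (\<integral>\<^sup>+ x. ennreal (f x) \<partial>\<nu>))) \<and>
    (stochastic_le le \<nu> \<mu> \<longleftrightarrow>
       (\<forall>f :: 'a \<Rightarrow> real. (\<forall>x. 0 \<le> f x) \<longrightarrow> antitone le f \<longrightarrow> bounded (range f) \<longrightarrow> f \<in> borel_measurable borel \<longrightarrow>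
          (\<integral>\<^sup>+ x. ennreal (f x) \<partial>\<mu>) \<le> (\<integral>\<^sup>+ x. ennreal (f x) \<partial>\<nu>))) \<and>
    (stochastic_le le \<nu> \<mu> \<longleftrightarrow>
       (\<forall>f :: 'a \<Rightarrow> real. (\<forall>x. 0 \<le> f x) \<longrightarrow> antitone le f \<longrightarrow> lower_semicontinuous f \<longrightarrow>
          (\<integral>\<^sup>+ x. ennreal (f x) \<partial>\<mu>) \<le> (\<integral>\<^sup>+ x. ennreal (f x) \<partial>\<nu>))) \<and>
    (stochastic_le le \<nu> \<mu> \<longleftrightarrow>
       (\<forall>f :: 'a \<Rightarrow> real. (\<forall>x. 0 \<le> f x) \<longrightarrow> antitone le f \<longrightarrow> bounded (range f) \<longrightarrow> lower_semicontinuous f \<longrightarrow>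
          (\<integral>\<^sup>+ x. ennreal (f x) \<partial>\<mu>) \<le> (\<integral>\<^sup>+ x. ennreal (f x) \<partial>\<nu>)))"
proof -
  note int_le = stochastic_le_imp_nn_integral_le[OF assms]
    and le_int = nn_integral_le_imp_stochastic_le[OF assms]
    and lsc = borel_measurable_lower_semicontinuous
  show ?thesis
    \<comment> \<open>Forward, \<open>int_le\<close> covers all Borel functions, with
      \<open>lsc\<close> giving measurability in the semicontinuous cases; backward, each condition
      is restricted to the class in \<open>le_int\<close>.\<close>
    by (intro conjI iffI allI impI; (rule int_le | rule le_int); blast intro: lsc)
qed

end
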